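(* Let $N$ be a positive integer, $Z=X+\sqrt{-1}Y\in\mathcal S_n$ a constant matrix, $\Omega=(Y+XY^{-1}X)^{-1}ZY^{-1}$ ($=\bar Z^{-1}$), and let $J_Z$ be the corresponding complex structure on $\mathbb R^{2n}=\mathbb R^n\times\mathbb R^n\ni(x,y)$. Define $F\colon\mathbb R^{2n}\to\mathbb C^n$ and $\tilde F\colon\mathbb R^{2n}\times\mathbb C\to\mathbb C^n\times\mathbb C$ by $$F(x,y)=N(-\Omega x+y),\qquad \tilde F(x,y,w)=\big(N(-\Omega x+y),\ e^{-\pi\sqrt{-1}N\,x\cdot\Omega x}\,w\big).$$ Then: (1) $J_{\sqrt{-1}I}\circ F=F\circ J_Z$, i.e. $F$ is a $\mathbb C$-linear isomorphism from $(\mathbb R^{2n},J_Z)$ to the standard complex vector space $(\mathbb C^n,J_{\sqrt{-1}I})$. (2) $\tilde F$ is equivariant with respect to the $\mathbb Z^{2n}=\mathbb Z^n\times\mathbb Z^n$-actions on $\mathbb R^{2n}\times\mathbb C$ and $\mathbb C^n\times\mathbb C$ defined by $$(\gamma,\gamma')\cdot(x,y,w)=\big(x+\gamma,\ y+\gamma',\ e^{2\pi\sqrt{-1}N\gamma\cdot y}w\big),$$ $$(\gamma,\gamma')\cdot(z,w)=\big(z+N(-\Omega\gamma+\gamma'),\ e^{-\pi\sqrt{-1}N\gamma\cdot\Omega\gamma+2\pi\sqrt{-1}\gamma\cdot z}w\big).$$ (3) For every $m\in\mathbb Z^n$ with $\frac mN\in[0,1)^n$, the section $\vartheta_{\frac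 mN}$ satisfies $\tilde F\circ\vartheta_{\frac mN}(x,y)=\vartheta\begin{bmatrix}\frac mN\\ 0\end{bmatrix}(F(x,y),N\Omega)$, i.e. $$\vartheta_{\frac mN}(x,y)=e^{\pi\sqrt{-1}N\,x\cdot\Omega x}\,\vartheta\begin{bmatrix}\frac mN\\ 0\end{bmatrix}\big(N(-\Omega x+y),\,N\Omega\big).$$
   Context: $\mathcal S_n$ is the Siegel upper half space: symmetric complex $n\times n$ matrices $X+\sqrt{-1}Y$ ($X,Y$ real) with $Y$ positive definite. $J_Z(u_x,u_y)=\big(XY^{-1}u_x-(Y+XY^{-1}X)u_y,\ Y^{-1}u_x-Y^{-1}Xu_y\big)$ for $(u_x,u_y)\in\mathbb R^n\times\mathbb R^n$; $J_{\sqrt{-1}I}$ is the standard complex structure (multiplication by $\sqrt{-1}$) on $\mathbb C^n$. $a\cdot b=\sum_i a_ib_i$ (bilinear, no conjugation). For $T\in\mathcal S_n$, $a,b\in\mathbb Q^n$, the theta function with rational characteristics is $\vartheta\begin{bmatrix}a\\ b\end{bmatrix}(z,T)=\sum_{\gamma\in\mathbb Z^n}e^{\pi\sqrt{-1}(\gamma+a)\cdot T(\gamma+a)+2\pi\sqrt{-1}(\gamma+a)\cdot(z+b)}$, viewed as a section of $\mathbb C^n\times\mathbb C\to\mathbb C^n$. The section $\vartheta_{\frac mN}$ is the one attached to the Lagrangian fibration $T^{2n}\to T^n$ with prequantum line bundle obtained as the quotient of $\mathbb R^{2n}\times\mathbb C\to\mathbb R^{2n}\to\mathbb R^n$ by the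 $\mathbb Z^{2n}=\mathbb Z^n\times\mathbb Z^n$-action $(\gamma,\gamma')\cdot(x,y,w)=\big(x+\gamma,\ y+\gamma',\ e^{2\pi\sqrt{-1}N\gamma\cdot y}w\big)$ on $\mathbb R^{2n}\times\mathbb C$ (the case of the $\mathbb Z^n$-action $x\mapsto x+\gamma$ on $\mathbb R^n\times T^n$ with lift $(x,y,w)\mapsto(x+\gamma,y,e^{2\pi\sqrt{-1}N\gamma\cdot y}w)$ and fundamental domain $[0,1)^n$), and it is explicitly $$\vartheta_{\frac mN}(x,y)=\sum_{\gamma\in\mathbb Z^n}e^{2\pi\sqrt{-1}\left\{\frac N2\left(x-\gamma-\frac mN\right)\cdot\Omega\left(x-\gamma-\frac mN\right)+(m+N\gamma)\cdot y\right\}}.$$ Sections of the trivial line bundles are identified with functions, so $\tilde F\circ\vartheta_{\frac mN}$ is identified with its $\mathbb C$-component. *)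

theory Defs
  imports "HOL-Analysis.Analysis"
begin

definition map_vec :: "('a \<Rightarrow> 'b) \<Rightarrow> 'a ^ 'n \<Rightarrow> 'b ^ 'n" where
  "map_vec f v = (\<chi> i. f (v $ i))"

text \<open>The bilinear product \<open>a \<cdot> b\<close>, without conjugation: on complex vectors it is neither
  the library's real-valued \<open>inner\<close> nor the Hermitian product.\<close>

definition bdot :: "complex ^ 'n \<Rightarrow> complex ^ 'n \<Rightarrow> complex" (infixl "\<cdot>" 70) where
  "a \<cdot> b = (\<Sum>i\<in>UNIV. a $ i * b $ i)"

definition siegel_upper_half_space :: "(complex ^ 'n ^ 'n) set" where
  "siegel_upper_half_space =
    {Z. transpose Z = Z \<and> (\<forall>v. v \<noteq> 0 \<longrightarrow> 0 < v \<bullet> (map_matrix Im Z *v v))}"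

definition J_siegel ::
  "complex ^ 'n ^ 'n \<Rightarrow> (real ^ 'n) \<times> (real ^ 'n) \<Rightarrow> (real ^ 'n) \<times> (real ^ 'n)" where
  "J_siegel Z = (\<lambda>(ux, uy).
     let X = map_matrix Re Z; Y = map_matrix Im Z; Y' = matrix_inv Y in
       ((X ** Y') *v ux - (Y + X ** Y' ** X) *v uy,
        Y' *v ux - (Y' ** X) *v uy))"

definition J_standard :: "complex ^ 'n \<Rightarrow> complex ^ 'n" where
  "J_standard z = \<i> *s z"

text \<open>The complex scalar multiplication \<open>(a + \<i> b) u = a u + b J u\<close> on a real vector space
  given by a complex structure \<open>J\<close>.\<close>

definition scale_of_J :: "('v::real_vector \<Rightarrow> 'v) \<Rightarrow> complex \<Rightarrow> 'v \<Rightarrow> 'v" where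
  "scale_of_J J c u = Re c *\<^sub>R u + Im c *\<^sub>R J u"

definition Omega :: "complex ^ 'n ^ 'n \<Rightarrow> complex ^ 'n ^ 'n" where
  "Omega Z =
    (let X = map_matrix Re Z; Y = map_matrix Im Z; Y' = matrix_inv Y in
       map_matrix complex_of_real (matrix_inv (Y + X ** Y' ** X)) ** Z **
       map_matrix complex_of_real Y')"

definition F_map ::
  "nat \<Rightarrow> complex ^ 'n ^ 'n \<Rightarrow> (real ^ 'n) \<times> (real ^ 'n) \<Rightarrow> complex ^ 'n" where
  "F_map N \<Omega> = (\<lambda>(x, y).
     of_nat N *s (- (\<Omega> *v map_vec of_real x) + map_vec of_real y))"

definition F_tilde ::
  "nat \<Rightarrow> complex ^ 'n ^ 'n \<Rightarrow> ((real ^ 'n) \<times> (real ^ 'n)) \<times> complex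
    \<Rightarrow> (complex ^ 'n) \<times> complex" where
  "F_tilde N \<Omega> = (\<lambda>((x, y), w).
     (F_map N \<Omega> (x, y),
      exp (- (pi * \<i> * of_nat N * (map_vec of_real x \<cdot> (\<Omega> *v map_vec of_real x)))) * w))"

definition is_action :: "('g::group_add \<Rightarrow> 'p \<Rightarrow> 'p) \<Rightarrow> bool" where
  "is_action act \<longleftrightarrow>
    (\<forall>p. act 0 p = p) \<and> (\<forall>g h p. act (g + h) p = act g (act h p))"

definition equivariant :: "('g \<Rightarrow> 'p \<Rightarrow> 'p) \<Rightarrow> ('g \<Rightarrow> 'q \<Rightarrow> 'q) \<Rightarrow> ('p \<Rightarrow> 'q) \<Rightarrow> bool" where
  "equivariant act act' f \<longleftrightarrow> (\<forall>g p. f (act g p) = act' g (f p))"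

definition real_action ::
  "nat \<Rightarrow> (int ^ 'n) \<times> (int ^ 'n) \<Rightarrow> ((real ^ 'n) \<times> (real ^ 'n)) \<times> complex
    \<Rightarrow> ((real ^ 'n) \<times> (real ^ 'n)) \<times> complex" where
  "real_action N = (\<lambda>(\<gamma>, \<gamma>') ((x, y), w).
     ((x + map_vec of_int \<gamma>, y + map_vec of_int \<gamma>'),
      exp (2 * pi * \<i> * of_nat N * (map_vec of_int \<gamma> \<cdot> map_vec of_real y)) * w))"

definition complex_action ::
  "nat \<Rightarrow> complex ^ 'n ^ 'n \<Rightarrow> (int ^ 'n) \<times> (int ^ 'n) \<Rightarrow> (complex ^ 'n) \<times> complex
    \<Rightarrow> (complex ^ 'n) \<times> complex" where
  "complex_action N \<Omega> = (\<lambda>(\<gamma>, \<gamma>') (z, w).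
     (z + of_nat N *s (- (\<Omega> *v map_vec of_int \<gamma>) + map_vec of_int \<gamma>'),
      exp (- (pi * \<i> * of_nat N * (map_vec of_int \<gamma> \<cdot> (\<Omega> *v map_vec of_int \<gamma>)))
           + 2 * pi * \<i> * (map_vec of_int \<gamma> \<cdot> z)) * w))"

definition riemann_theta_term ::
  "rat ^ 'n \<Rightarrow> rat ^ 'n \<Rightarrow> complex ^ 'n \<Rightarrow> complex ^ 'n ^ 'n \<Rightarrow> int ^ 'n \<Rightarrow> complex" where
  "riemann_theta_term a b z T \<gamma> =
    (let v = map_vec of_int \<gamma> + map_vec of_rat a in
       exp (pi * \<i> * (v \<cdot> (T *v v)) + 2 * pi * \<i> * (v \<cdot> (z + map_vec of_rat b))))"

definition riemann_theta ::
  "rat ^ 'n \<Rightarrow> rat ^ 'n \<Rightarrow> complex ^ 'n \<Rightarrow> complex ^ 'n ^ 'n \<Rightarrow> complex" where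
  "riemann_theta a b z T = (\<Sum>\<^sub>\<infinity>\<gamma>\<in>UNIV. riemann_theta_term a b z T \<gamma>)"

definition characteristic :: "nat \<Rightarrow> int ^ 'n \<Rightarrow> rat ^ 'n" where
  "characteristic N m = (\<chi> i. of_int (m $ i) / of_nat N)"

definition fibre_theta_term ::
  "nat \<Rightarrow> complex ^ 'n ^ 'n \<Rightarrow> int ^ 'n \<Rightarrow> (real ^ 'n) \<times> (real ^ 'n) \<Rightarrow> int ^ 'n \<Rightarrow> complex" where
  "fibre_theta_term N \<Omega> m = (\<lambda>(x, y) \<gamma>.
     let v = map_vec of_real x - map_vec of_int \<gamma> - map_vec of_rat (characteristic N m) in
       exp (2 * pi * \<i> *
         (of_nat N / 2 * (v \<cdot> (\<Omega> *v v))
          + (map_vec of_int m + of_nat N *s map_vec of_int \<gamma>) \<cdot> map_vec of_real y)))"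

definition fibre_theta ::
  "nat \<Rightarrow> complex ^ 'n ^ 'n \<Rightarrow> int ^ 'n \<Rightarrow> (real ^ 'n) \<times> (real ^ 'n) \<Rightarrow> complex" where
  "fibre_theta N \<Omega> m p = (\<Sum>\<^sub>\<infinity>\<gamma>\<in>UNIV. fibre_theta_term N \<Omega> m p \<gamma>)"

text \<open>The section of the trivial line bundle over \<open>'b\<close> with \<open>\<complex>\<close>-component \<open>s\<close>.\<close>

definition section_of :: "('b \<Rightarrow> complex) \<Rightarrow> 'b \<Rightarrow> 'b \<times> complex" where
  "section_of s p = (p, s p)"

end

theory Submission
  imports Defs
begin

text \<open>Everything rests on the identity \<open>Z Y\<^sup>-\<^sup>1 (cnj Z) = Y + X Y\<^sup>-\<^sup>1 X\<close> for \<open>Z = X + \<i> Y\<close> in the Siegel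
  space.  The right-hand side is a sum of a positive definite and a positive semidefinite real
  matrix, hence positive definite and invertible, so \<open>\<Omega>\<close> is the inverse of \<open>cnj Z\<close>
  (\<open>Omega_mult_cnj\<close>).  In particular \<open>\<Omega>\<close> is symmetric, and its imaginary part turns out to be
  the inverse of \<open>Y + X Y\<^sup>-\<^sup>1 X\<close> (\<open>Im_Omega\<close>), so \<open>\<Omega>\<close> and \<open>N \<Omega>\<close> lie in the Siegel space as well.

  Writing \<open>F (x, y) = N \<Omega> (cnj Z y - x)\<close> turns the claim on complex structures into a short
  computation with \<open>X\<close> and \<open>Y\<close> (\<open>F_map_J_siegel\<close>), and bijectivity of \<open>F\<close> into solving
  \<open>cnj Z y - x = w\<close> for real \<open>x\<close> and \<open>y\<close>, first for \<open>y\<close> from the imaginary part.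

  Equivariance and the comparison of the theta functions are both the expansion of a symmetric
  quadratic form at a sum.  The comparison holds term by term, with a prefactor independent of
  the summation index (\<open>fibre_theta_term_eq\<close>).  Integrality enters only in the action laws, where
  the two sides differ by a factor \<open>exp (2 \<pi> \<i> N \<gamma> \<cdot> \<delta>')\<close>.  Convergence of the Riemann theta series
  for any matrix in the Siegel space (\<open>riemann_theta_term_summable\<close>) comes from bounding the
  imaginary part below by a multiple of the identity, and it transfers to the other
  series through the term-by-term identity.\<close>

section \<open>Vectors, matrices and the bilinear product\<close>

lemma map_vec_nth [simp]: "map_vec f v $ i = f (v $ i)"
  by (simp add: map_vec_def)

lemma map_vec_of_real_mult:
  "map_vec complex_of_real (A *v x) = map_matrix complex_of_real A *v map_vec complex_of_real x"
  by (simp add: vec_eq_iff matrix_vector_mult_def)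

lemma map_vec_of_real_add: "map_vec complex_of_real (x + y) = map_vec of_real x + map_vec of_real y"
  and map_vec_of_real_diff: "map_vec complex_of_real (x - y) = map_vec of_real x - map_vec of_real y"
  and map_vec_of_real_of_int: "map_vec complex_of_real (map_vec of_int k) = map_vec of_int k"
  and map_vec_of_int_add:
    "map_vec complex_of_int (k + l) = map_vec of_int k + map_vec of_int l"
  by (simp_all add: vec_eq_iff)

lemma of_real_of_rat: "complex_of_real (of_rat q) = of_rat q"
  by (cases q) (simp add: of_rat_rat)

lemma map_vec_of_int_zero [simp]: "map_vec of_int 0 = 0"
  and map_vec_of_rat_zero [simp]: "map_vec of_rat 0 = 0"
  by (simp_all add: vec_eq_iff)

lemma map_matrix_of_real_mult:
  "map_matrix complex_of_real (A ** B) = map_matrix complex_of_real A ** map_matrix complex_of_real B"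
  and map_matrix_of_real_add:
  "map_matrix complex_of_real (A + C) = map_matrix complex_of_real A + map_matrix complex_of_real C"
  by (simp_all add: vec_eq_iff matrix_matrix_mult_def)

lemma map_matrix_of_real_mat_1 [simp]: "map_matrix complex_of_real (mat 1) = mat 1"
  by (simp add: vec_eq_iff mat_def)

lemma complex_matrix_mult_vec:
  "Z *v u = map_matrix complex_of_real (map_matrix Re Z) *v u
     + \<i> *s (map_matrix complex_of_real (map_matrix Im Z) *v u)"
  by (simp add: vec_eq_iff matrix_vector_mult_def sum_distrib_left flip: sum.distrib)
    (simp add: complex_eq_iff algebra_simps)

lemma cnj_matrix_mult_vec:
  "map_matrix cnj Z *v u = map_matrix complex_of_real (map_matrix Re Z) *v u
     - \<i> *s (map_matrix complex_of_real (map_matrix Im Z) *v u)"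
  by (simp add: vec_eq_iff matrix_vector_mult_def sum_distrib_left flip: sum_subtractf)
    (simp add: complex_eq_iff algebra_simps)

lemma Im_matrix_mult_of_real:
  "map_vec Im (T *v map_vec complex_of_real v) = map_matrix Im T *v v"
  by (simp add: vec_eq_iff matrix_vector_mult_def)

lemma matrix_inv_inverse:
  fixes A :: "'a::field ^ 'n ^ 'n"
  assumes "invertible A"
  shows "A ** matrix_inv A = mat 1" "matrix_inv A ** A = mat 1"
  using someI_ex[OF assms[unfolded invertible_def]] by (simp_all add: matrix_inv_def)

lemma matrix_inv_unique:
  fixes A :: "'a::field ^ 'n ^ 'n"
  assumes "B ** A = mat 1"
  shows "matrix_inv A = B"
proof -
  have "invertible A"
    using assms invertible_left_inverse by blast
  then have "B ** (A ** matrix_inv A) = B"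
    by (simp add: matrix_inv_inverse)
  then show ?thesis
    by (simp add: matrix_mul_assoc assms)
qed

lemma matrix_inv_mult_vec:
  fixes A :: "'a::field ^ 'n ^ 'n"
  assumes "invertible A"
  shows "A *v (matrix_inv A *v u) = u" "matrix_inv A *v (A *v u) = u"
  using matrix_inv_inverse[OF assms] by (simp_all add: matrix_vector_mul_assoc)

lemma of_real_matrix_inv_mult_vec:
  assumes "invertible A"
  shows "map_matrix complex_of_real A *v (map_matrix complex_of_real (matrix_inv A) *v u) = u"
    "map_matrix complex_of_real (matrix_inv A) *v (map_matrix complex_of_real A *v u) = u"
  using matrix_inv_inverse[OF assms]
  by (simp_all add: matrix_vector_mul_assoc flip: map_matrix_of_real_mult)

lemma transpose_matrix_inv:
  fixes A :: "'a::field ^ 'n ^ 'n"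
  assumes "invertible A" "transpose A = A"
  shows "transpose (matrix_inv A) = matrix_inv A"
  by (metis assms matrix_inv_inverse(1) matrix_inv_unique matrix_transpose_mul transpose_mat)

lemma inner_symmetric_matrix:
  fixes A :: "real ^ 'n ^ 'n"
  assumes "transpose A = A"
  shows "(A *v u) \<bullet> v = u \<bullet> (A *v v)"
  by (metis assms dot_lmul_matrix transpose_matrix_vector)

lemma bdot_add_left: "(a + b) \<cdot> c = a \<cdot> c + b \<cdot> c"
  and bdot_add_right: "c \<cdot> (a + b) = c \<cdot> a + c \<cdot> b"
  and bdot_diff_left: "(a - b) \<cdot> c = a \<cdot> c - b \<cdot> c"
  and bdot_diff_right: "c \<cdot> (a - b) = c \<cdot> a - c \<cdot> b"
  and bdot_minus_right: "c \<cdot> (- a) = - (c \<cdot> a)"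
  and bdot_scale_left: "(k *s a) \<cdot> c = k * (a \<cdot> c)"
  and bdot_scale_right: "c \<cdot> (k *s a) = k * (c \<cdot> a)"
  by (simp_all add: bdot_def algebra_simps sum.distrib sum_subtractf sum_distrib_left sum_negf)

lemmas bdot_linear = bdot_add_left bdot_add_right bdot_diff_left bdot_diff_right bdot_minus_right
  bdot_scale_left bdot_scale_right

lemma bdot_zero_left [simp]: "0 \<cdot> b = 0"
  by (simp add: bdot_def)

lemma bdot_symmetric_matrix:
  assumes "transpose T = T"
  shows "u \<cdot> (T *v v) = v \<cdot> (T *v u)"
proof -
  have "T $ i $ j = T $ j $ i" for i j
    using assms by (metis transpose_def vec_lambda_beta)
  then have "u \<cdot> (T *v v) = (\<Sum>i\<in>UNIV. \<Sum>j\<in>UNIV. v $ j * (T $ j $ i * u $ i))"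
    by (simp add: bdot_def matrix_vector_mult_def sum_distrib_left mult_ac)
  also have "\<dots> = v \<cdot> (T *v u)"
    by (subst sum.swap) (simp add: bdot_def matrix_vector_mult_def sum_distrib_left)
  finally show ?thesis .
qed

lemma Im_bdot_of_real: "Im (map_vec complex_of_real u \<cdot> z) = u \<bullet> map_vec Im z"
  by (simp add: bdot_def inner_vec_def)

lemma exp_2pi_i_of_int_bdot:
  "exp (2 * pi * \<i> * of_nat N * (map_vec of_int k \<cdot> map_vec of_int l)) = 1"
proof -
  have "map_vec complex_of_int k \<cdot> map_vec of_int l = of_int (\<Sum>i\<in>UNIV. k $ i * l $ i)"
    by (simp add: bdot_def)
  then have "2 * pi * \<i> * of_nat N * (map_vec of_int k \<cdot> map_vec of_int l)
      = \<i> * (of_int (int N * (\<Sum>i\<in>UNIV. k $ i * l $ i)) * (complex_of_real pi * 2))"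
    by simp
  then show ?thesis
    by (simp only: exp_2pi_1_int)
qed

section \<open>Positive definite matrices\<close>

lemma positive_definite_invertible:
  fixes A :: "real ^ 'n ^ 'n"
  assumes "\<And>v. v \<noteq> 0 \<Longrightarrow> 0 < v \<bullet> (A *v v)"
  shows "invertible A"
proof -
  have "inj ((*v) A)"
  proof (rule injI)
    fix u v assume "A *v u = A *v v"
    then have "A *v (u - v) = 0"
      by (simp add: algebra_simps)
    then show "u = v"
      using assms[of "u - v"] by auto
  qed
  then show ?thesis
    by (simp add: invertible_left_inverse matrix_left_invertible_injective)
qed

lemma positive_definite_matrix_inv:
  fixes A :: "real ^ 'n ^ 'n"
  assumes pos: "\<And>v. v \<noteq> 0 \<Longrightarrow> 0 < v \<bullet> (A *v v)" and "v \<noteq> 0"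
  shows "0 < v \<bullet> (matrix_inv A *v v)"
proof -
  note inv = matrix_inv_mult_vec[OF positive_definite_invertible[OF pos]]
  let ?w = "matrix_inv A *v v"
  have "?w \<noteq> 0"
    using inv(1)[of v] \<open>v \<noteq> 0\<close> by auto
  then have "0 < ?w \<bullet> (A *v ?w)"
    by (rule pos)
  then show ?thesis
    by (simp add: inv inner_commute)
qed

text \<open>The minimum of the quadratic form over the compact unit sphere serves as the constant.\<close>

lemma positive_definite_lower_bound:
  fixes A :: "real ^ 'n ^ 'n"
  assumes pos: "\<And>v. v \<noteq> 0 \<Longrightarrow> 0 < v \<bullet> (A *v v)"
  obtains c where "c > 0" "\<And>v. c * (v \<bullet> v) \<le> v \<bullet> (A *v v)"
proof -
  let ?q = "\<lambda>v::real^'n. v \<bullet> (A *v v)"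
  have "compact (sphere (0::real^'n) 1)" "sphere (0::real^'n) 1 \<noteq> {}"
    by (simp_all add: sphere_eq_empty)
  moreover have "continuous_on (sphere 0 1) ?q"
    by (intro continuous_intros)
  ultimately obtain e where e: "e \<in> sphere 0 1" "\<And>v. v \<in> sphere 0 1 \<Longrightarrow> ?q e \<le> ?q v"
    using continuous_attains_inf[of "sphere 0 1" ?q] by blast
  show thesis
  proof
    show "?q e > 0"
      using e(1) by (intro pos) auto
    show "?q e * (v \<bullet> v) \<le> ?q v" for v
    proof (cases "v = 0")
      case False
      then have "?q e \<le> ?q ((1 / norm v) *\<^sub>R v)"
        by (intro e(2)) simp
      also have "\<dots> = ?q v / (v \<bullet> v)"
        by (simp add: matrix_vector_mult_scaleR power2_eq_square flip: power2_norm_eq_inner)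
      finally show ?thesis
        using False by (simp add: field_simps)
    qed simp
  qed
qed

section \<open>The matrix \<open>\<Omega>\<close>\<close>

text \<open>The matrix whose inverse is the left factor of \<open>\<Omega>\<close>.\<close>

definition siegel_denominator :: "complex ^ 'n ^ 'n \<Rightarrow> real ^ 'n ^ 'n" where
  "siegel_denominator Z =
    map_matrix Im Z + map_matrix Re Z ** matrix_inv (map_matrix Im Z) ** map_matrix Re Z"

lemma Omega_eq:
  "Omega Z = map_matrix complex_of_real (matrix_inv (siegel_denominator Z)) ** Z **
     map_matrix complex_of_real (matrix_inv (map_matrix Im Z))"
  by (simp add: Omega_def siegel_denominator_def Let_def)

lemma siegel_invertible_Im:
  assumes "Z \<in> siegel_upper_half_space"
  shows "invertible (map_matrix Im Z)"
  using assms by (intro positive_definite_invertible) (simp add: siegel_upper_half_space_def)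

text \<open>Since \<open>X\<close> is symmetric, the quadratic form at \<open>v\<close> is that of \<open>Y\<close> at \<open>v\<close> plus that of the
  inverse of \<open>Y\<close> at \<open>X v\<close>.\<close>

lemma siegel_denominator_positive:
  assumes Z: "Z \<in> siegel_upper_half_space" and "v \<noteq> 0"
  shows "0 < v \<bullet> (siegel_denominator Z *v v)"
proof -
  let ?X = "map_matrix Re Z" and ?Y = "map_matrix Im Z"
  have pos: "0 < u \<bullet> (?Y *v u)" if "u \<noteq> 0" for u
    using Z that by (simp add: siegel_upper_half_space_def)
  have "transpose Z = Z"
    using Z by (simp add: siegel_upper_half_space_def)
  then have "transpose ?X = ?X"
    by (simp add: vec_eq_iff transpose_def)
  then have "v \<bullet> (siegel_denominator Z *v v)
      = v \<bullet> (?Y *v v) + (?X *v v) \<bullet> (matrix_inv ?Y *v (?X *v v))"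
    by (simp add: siegel_denominator_def matrix_vector_mult_add_rdistrib inner_add_right
        inner_symmetric_matrix flip: matrix_vector_mul_assoc)
  moreover have "0 \<le> (?X *v v) \<bullet> (matrix_inv ?Y *v (?X *v v))"
    by (cases "?X *v v = 0") (auto intro: less_imp_le positive_definite_matrix_inv pos)
  ultimately show ?thesis
    using pos[OF \<open>v \<noteq> 0\<close>] by linarith
qed

text \<open>In \<open>(X + \<i> Y) Y\<^sup>-\<^sup>1 (X - \<i> Y)\<close> the mixed terms \<open>\<plusminus>\<i> X\<close> cancel, and what remains is
  \<open>Y + X Y\<^sup>-\<^sup>1 X\<close>.\<close>

lemma Omega_mult_cnj:
  assumes Z: "Z \<in> siegel_upper_half_space"
  shows "Omega Z ** map_matrix cnj Z = mat 1"
proof -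
  let ?C = "map_matrix complex_of_real"
  let ?X = "map_matrix Re Z" and ?Y = "map_matrix Im Z" and ?A = "siegel_denominator Z"
  note Y_inv = of_real_matrix_inv_mult_vec[OF siegel_invertible_Im[OF Z]]
  have A_inv: "?C (matrix_inv ?A) *v (?C ?A *v u) = u" for u
    by (intro of_real_matrix_inv_mult_vec positive_definite_invertible
        siegel_denominator_positive Z)
  have "Z *v (?C (matrix_inv ?Y) *v (map_matrix cnj Z *v u)) = ?C ?A *v u" for u
    unfolding cnj_matrix_mult_vec complex_matrix_mult_vec[of Z]
    by (simp add: siegel_denominator_def map_matrix_of_real_add map_matrix_of_real_mult
        matrix_vector_mult_add_rdistrib matrix_vector_right_distrib matrix_vector_mult_diff_distrib
        vector_scalar_commute Y_inv vector_ssub_ldistrib vector_smult_assoc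
        flip: matrix_vector_mul_assoc)
  then show ?thesis
    by (simp add: matrix_eq Omega_eq A_inv flip: matrix_vector_mul_assoc)
qed

lemma invertible_cnj_siegel:
  assumes "Z \<in> siegel_upper_half_space"
  shows "invertible (map_matrix cnj Z)"
  using Omega_mult_cnj[OF assms] invertible_left_inverse by blast

lemma Omega_eq_matrix_inv_cnj:
  assumes "Z \<in> siegel_upper_half_space"
  shows "Omega Z = matrix_inv (map_matrix cnj Z)"
  using matrix_inv_unique[OF Omega_mult_cnj[OF assms]] by simp

text \<open>In \<open>\<Omega> = A\<^sup>-\<^sup>1 (X + \<i> Y) Y\<^sup>-\<^sup>1\<close> with \<open>A = Y + X Y\<^sup>-\<^sup>1 X\<close>, the outer factors are real, and \<open>Y\<close>
  cancels in the imaginary part.\<close>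

lemma Im_Omega:
  assumes Z: "Z \<in> siegel_upper_half_space"
  shows "map_matrix Im (Omega Z) = matrix_inv (siegel_denominator Z)"
proof -
  let ?C = "map_matrix complex_of_real" and ?c = "map_vec complex_of_real"
  let ?X = "map_matrix Re Z" and ?Y = "map_matrix Im Z" and ?A' = "matrix_inv (siegel_denominator Z)"
  have "Omega Z *v ?c v = ?c (?A' *v (?X *v (matrix_inv ?Y *v v))) + \<i> *s ?c (?A' *v v)" for v
    by (simp add: Omega_eq complex_matrix_mult_vec[of Z] map_vec_of_real_mult
        matrix_vector_right_distrib vector_scalar_commute
        of_real_matrix_inv_mult_vec[OF siegel_invertible_Im[OF Z]] flip: matrix_vector_mul_assoc)
  then have "map_vec Im (Omega Z *v ?c v) = ?A' *v v" for v
    by (simp add: vec_eq_iff)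
  then show ?thesis
    by (simp add: Im_matrix_mult_of_real matrix_eq)
qed

lemma Omega_in_siegel:
  assumes Z: "Z \<in> siegel_upper_half_space"
  shows "Omega Z \<in> siegel_upper_half_space"
proof -
  have "transpose Z = Z"
    using Z by (simp add: siegel_upper_half_space_def)
  then have "transpose (map_matrix cnj Z) = map_matrix cnj Z"
    by (simp add: vec_eq_iff transpose_def)
  then have "transpose (Omega Z) = Omega Z"
    by (simp add: Omega_eq_matrix_inv_cnj Z transpose_matrix_inv invertible_cnj_siegel)
  then show ?thesis
    by (auto simp: siegel_upper_half_space_def Im_Omega[OF Z]
        intro: positive_definite_matrix_inv siegel_denominator_positive[OF Z])
qed

lemma siegel_scaleR:
  assumes "T \<in> siegel_upper_half_space" "0 < c"
  shows "c *\<^sub>R T \<in> siegel_upper_half_space"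
proof -
  have "map_matrix Im (c *\<^sub>R T) = c *\<^sub>R map_matrix Im T"
    by (simp add: vec_eq_iff)
  then show ?thesis
    using assms by (simp add: siegel_upper_half_space_def transpose_scalar
        scaleR_matrix_vector_assoc[symmetric])
qed

section \<open>The complex linear isomorphism \<open>F\<close>\<close>

lemma F_map_add: "F_map N \<Omega> (p + q) = F_map N \<Omega> p + F_map N \<Omega> q"
  by (cases p; cases q) (simp add: F_map_def map_vec_of_real_add matrix_vector_right_distrib
      vec_eq_iff algebra_simps)

lemma F_map_scaleR:
  fixes \<Omega> :: "complex ^ 'n ^ 'n"
  shows "F_map N \<Omega> (r *\<^sub>R p) = complex_of_real r *s F_map N \<Omega> p"
proof -
  have scale: "map_vec complex_of_real (r *\<^sub>R x) = of_real r *s map_vec of_real x" for x :: "real ^ 'n"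
    by (simp add: vec_eq_iff)
  show ?thesis
    by (cases p) (simp add: F_map_def scale vector_scalar_commute, simp add: vec_eq_iff algebra_simps)
qed

text \<open>Pulling \<open>\<Omega>\<close> out of \<open>F\<close> leaves a map without inverse matrices, on which both the
  compatibility with the complex structures and bijectivity can be read off.\<close>

lemma F_map_factor:
  assumes "Z \<in> siegel_upper_half_space"
  shows "F_map N (Omega Z) (x, y)
    = of_nat N *s (Omega Z *v (map_matrix cnj Z *v map_vec of_real y - map_vec of_real x))"
  using Omega_mult_cnj[OF assms]
  by (simp add: F_map_def matrix_vector_mult_diff_distrib matrix_vector_mul_assoc)

lemma F_map_J_siegel:
  assumes Z: "Z \<in> siegel_upper_half_space"
  shows "F_map N (Omega Z) (J_siegel Z p) = \<i> *s F_map N (Omega Z) p"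
proof -
  obtain x y where p: "p = (x, y)" by force
  obtain x' y' where J: "J_siegel Z (x, y) = (x', y')" by force
  note Y_inv = of_real_matrix_inv_mult_vec[OF siegel_invertible_Im[OF Z]]
  let ?c = "map_vec complex_of_real"
  have "map_matrix cnj Z *v ?c y' - ?c x' = \<i> *s (map_matrix cnj Z *v ?c y - ?c x)"
    using J
    by (auto simp: J_siegel_def Let_def cnj_matrix_mult_vec map_vec_of_real_diff
        map_vec_of_real_add map_vec_of_real_mult matrix_vector_mult_add_rdistrib
        matrix_vector_mult_diff_distrib vector_ssub_ldistrib vector_smult_assoc Y_inv
        simp flip: matrix_vector_mul_assoc)
  then show ?thesis
    unfolding p J F_map_factor[OF Z]
    by (simp add: vector_scalar_commute vector_smult_assoc mult.commute del: vector_ssub_ldistrib)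
qed

text \<open>For real \<open>x\<close> and \<open>y\<close> the imaginary part of \<open>cnj Z y - x\<close> is \<open>- Y y\<close>, which determines \<open>y\<close>;
  the real part \<open>X y - x\<close> then determines \<open>x\<close>.\<close>

lemma bij_cnj_siegel_coordinates:
  assumes Z: "Z \<in> siegel_upper_half_space"
  shows "bij (\<lambda>(x, y). map_matrix cnj Z *v map_vec of_real y - map_vec of_real x)"
    (is "bij ?G")
proof -
  let ?X = "map_matrix Re Z" and ?Y = "map_matrix Im Z"
  note Y_inv = matrix_inv_mult_vec[OF siegel_invertible_Im[OF Z]]
  define H where "H w = (let y = - (matrix_inv ?Y *v map_vec Im w) in (?X *v y - map_vec Re w, y))"
    for w
  have G: "?G (x, y) = map_vec of_real (?X *v y - x) - \<i> *s map_vec of_real (?Y *v y)" for x y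
    by (simp add: cnj_matrix_mult_vec map_vec_of_real_mult map_vec_of_real_diff)
  have minus: "A *v (- u) = - (A *v u)" for A :: "real ^ 'n ^ 'n" and u
    using matrix_vector_mult_scaleR[of A "-1" u] by simp
  have "map_vec Im (?G (x, y)) = - (?Y *v y)" "map_vec Re (?G (x, y)) = ?X *v y - x" for x y
    unfolding G by (simp_all add: vec_eq_iff)
  then have "H (?G (x, y)) = (x, y)" for x y
    by (simp add: H_def Let_def minus Y_inv del: case_prod_conv)
  then have HG: "H (?G p) = p" for p
    by (metis surj_pair)
  have "?G (H w) = map_vec of_real (map_vec Re w) + \<i> *s map_vec of_real (map_vec Im w)" for w
    unfolding H_def Let_def G by (simp add: minus Y_inv vec_eq_iff)
  also have "\<dots> w = w" for w
    by (simp add: vec_eq_iff complex_eq_iff)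
  finally have GH: "?G (H w) = w" for w .
  show ?thesis
    by (rule bijI') (metis HG, metis GH)
qed

lemma bij_F_map:
  assumes Z: "Z \<in> siegel_upper_half_space" and "0 < N"
  shows "bij (F_map N (Omega Z))"
proof -
  have "F_map N (Omega Z) = (*s) (of_nat N) \<circ> ((*v) (Omega Z) \<circ>
      (\<lambda>(x, y). map_matrix cnj Z *v map_vec of_real y - map_vec of_real x))"
    by (auto simp: F_map_factor Z)
  moreover have "bij ((*s) (of_nat N) :: complex ^ 'n \<Rightarrow> _)"
    using \<open>0 < N\<close> by (intro o_bij[of "(*s) (inverse (of_nat N))"])
      (auto simp: vector_smult_assoc)
  moreover have "bij ((*v) (Omega Z))"
    using Omega_mult_cnj[OF Z] by (metis invertible_eq_bij invertible_right_inverse)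
  ultimately show ?thesis
    using bij_cnj_siegel_coordinates[OF Z] by (metis bij_comp)
qed

text \<open>An injective real-linear map into a complex vector space that turns \<open>J\<close> into
  multiplication by \<open>\<i>\<close> also turns \<open>scale_of_J J\<close> into complex scalar multiplication.  By injectivity
  the vector space axioms can be checked in the target; in particular, linearity of \<open>J\<close> and
  \<open>J (J u) = - u\<close> come out as consequences.\<close>

lemma linear_scale_of_J:
  fixes f :: "'v::real_vector \<Rightarrow> complex ^ 'n"
  assumes "inj f" and add: "\<And>u v. f (u + v) = f u + f v"
    and scale: "\<And>r u. f (r *\<^sub>R u) = of_real r *s f u"
    and J: "\<And>u. f (J u) = \<i> *s f u"
  shows "Vector_Spaces.linear (scale_of_J J) (*s) f"
proof -
  have f_scale: "f (scale_of_J J c u) = c *s f u" for c u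
    by (simp add: scale_of_J_def add scale J vector_smult_assoc flip: vector_sadd_rdistrib)
      (simp add: complex_eq_iff)
  have "vector_space (scale_of_J J)"
    by unfold_locales
      (rule injD[OF \<open>inj f\<close>], simp add: f_scale add vector_add_ldistrib vector_sadd_rdistrib
        vector_smult_assoc)+
  then show ?thesis
    by (intro Vector_Spaces.linear.intro module_hom.intro module_hom_axioms.intro)
      (auto simp: add f_scale vector_space_def module_def vec.vector_space_axioms)
qed

section \<open>The lattice actions\<close>

lemma is_action_real_action: "is_action (real_action N :: (int ^ 'n) \<times> (int ^ 'n) \<Rightarrow> _)"
proof -
  have "real_action N (g + h) p = real_action N g (real_action N h p)"
    for g h :: "(int ^ 'n) \<times> (int ^ 'n)" and p
  proof -
    obtain x y w where p: "p = ((x, y), w)" by (metis surj_pair)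
    obtain k k' l l' where g: "g = (k, k')" "h = (l, l')" by force
    (* Moving y by the lattice vector l' changes the phase of g by whole periods. *)
    have "exp (2 * pi * \<i> * of_nat N * (map_vec of_int (k + l) \<cdot> map_vec of_real y))
      = exp (2 * pi * \<i> * of_nat N * (map_vec of_int k \<cdot> map_vec of_real (y + map_vec of_int l')))
        * exp (2 * pi * \<i> * of_nat N * (map_vec of_int l \<cdot> map_vec of_real y))"
      by (simp add: map_vec_of_real_add map_vec_of_int_add map_vec_of_real_of_int bdot_linear
          distrib_left exp_add exp_2pi_i_of_int_bdot[simplified])
    then show ?thesis
      by (simp add: p g real_action_def vec_eq_iff)
  qed
  moreover have "real_action N 0 p = p" for p :: "((real ^ 'n) \<times> (real ^ 'n)) \<times> complex"
    by (auto simp: real_action_def zero_prod_def)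
  ultimately show ?thesis
    by (simp add: is_action_def)
qed

lemma is_action_complex_action:
  fixes \<Omega> :: "complex ^ 'n ^ 'n"
  assumes sym: "transpose \<Omega> = \<Omega>"
  shows "is_action (complex_action N \<Omega>)"
proof -
  have "complex_action N \<Omega> (g + h) p = complex_action N \<Omega> g (complex_action N \<Omega> h p)" for g h p
  proof -
    obtain z w where p: "p = (z, w)" by force
    obtain k k' l l' where g: "g = (k, k')" "h = (l, l')" by force
    let ?c = "map_vec complex_of_int"
    have expo: "- (pi * \<i> * of_nat N * (?c (k + l) \<cdot> (\<Omega> *v ?c (k + l)))) + 2 * pi * \<i> * (?c (k + l) \<cdot> z)
        + 2 * pi * \<i> * of_nat N * (?c k \<cdot> ?c l')
      = (- (pi * \<i> * of_nat N * (?c k \<cdot> (\<Omega> *v ?c k)))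
          + 2 * pi * \<i> * (?c k \<cdot> (z + of_nat N *s (- (\<Omega> *v ?c l) + ?c l'))))
        + (- (pi * \<i> * of_nat N * (?c l \<cdot> (\<Omega> *v ?c l))) + 2 * pi * \<i> * (?c l \<cdot> z))"
      (* Symmetry of \<Omega> merges the two mixed terms of the quadratic form. *)
      using bdot_symmetric_matrix[OF sym, of "?c l" "?c k"]
      by (simp add: map_vec_of_int_add matrix_vector_right_distrib bdot_linear algebra_simps)
    have "exp (- (pi * \<i> * of_nat N * (?c (k + l) \<cdot> (\<Omega> *v ?c (k + l)))) + 2 * pi * \<i> * (?c (k + l) \<cdot> z))
      = exp (- (pi * \<i> * of_nat N * (?c k \<cdot> (\<Omega> *v ?c k)))
          + 2 * pi * \<i> * (?c k \<cdot> (z + of_nat N *s (- (\<Omega> *v ?c l) + ?c l'))))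
        * exp (- (pi * \<i> * of_nat N * (?c l \<cdot> (\<Omega> *v ?c l))) + 2 * pi * \<i> * (?c l \<cdot> z))"
      using arg_cong[OF expo, of exp] by (simp only: exp_add exp_2pi_i_of_int_bdot mult_1_right)
    moreover have "z + of_nat N *s (- (\<Omega> *v ?c (k + l)) + ?c (k' + l'))
      = z + of_nat N *s (- (\<Omega> *v ?c l) + ?c l') + of_nat N *s (- (\<Omega> *v ?c k) + ?c k')"
      by (simp add: map_vec_of_int_add matrix_vector_right_distrib vec_eq_iff algebra_simps)
    ultimately show ?thesis
      by (simp add: p g complex_action_def)
  qed
  moreover have "complex_action N \<Omega> 0 p = p" for p
    by (auto simp: complex_action_def zero_prod_def)
  ultimately show ?thesis
    by (simp add: is_action_def)
qed

text \<open>Expanding \<open>(x + \<gamma>) \<cdot> \<Omega> (x + \<gamma>)\<close> by symmetry, the mixed term \<open>2 \<gamma> \<cdot> \<Omega> x\<close> together with \<open>\<gamma> \<cdot> y\<close>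
  assembles to \<open>\<gamma> \<cdot> F (x, y)\<close>; so the two exponents agree exactly, not just up to a period.\<close>

lemma equivariant_F_tilde:
  fixes \<Omega> :: "complex ^ 'n ^ 'n"
  assumes sym: "transpose \<Omega> = \<Omega>"
  shows "equivariant (real_action N) (complex_action N \<Omega>) (F_tilde N \<Omega>)"
proof -
  have "F_tilde N \<Omega> (real_action N g p) = complex_action N \<Omega> g (F_tilde N \<Omega> p)" for g p
  proof -
    obtain x y w where p: "p = ((x, y), w)" by (metis surj_pair)
    obtain k k' where g: "g = (k, k')" by force
    let ?c = "map_vec complex_of_int" and ?r = "map_vec complex_of_real"
    have "- (pi * \<i> * of_nat N * ((?r x + ?c k) \<cdot> (\<Omega> *v (?r x + ?c k))))
        + 2 * pi * \<i> * of_nat N * (?c k \<cdot> ?r y)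
      = (- (pi * \<i> * of_nat N * (?c k \<cdot> (\<Omega> *v ?c k)))
          + 2 * pi * \<i> * (?c k \<cdot> (of_nat N *s (- (\<Omega> *v ?r x) + ?r y))))
        + - (pi * \<i> * of_nat N * (?r x \<cdot> (\<Omega> *v ?r x)))"
      using bdot_symmetric_matrix[OF sym, of "?r x" "?c k"]
      by (simp add: matrix_vector_right_distrib bdot_linear algebra_simps)
    from arg_cong[OF this, of exp]
    have "exp (- (pi * \<i> * of_nat N * ((?r x + ?c k) \<cdot> (\<Omega> *v (?r x + ?c k)))))
        * exp (2 * pi * \<i> * of_nat N * (?c k \<cdot> ?r y))
      = exp (- (pi * \<i> * of_nat N * (?c k \<cdot> (\<Omega> *v ?c k)))
          + 2 * pi * \<i> * (?c k \<cdot> (of_nat N *s (- (\<Omega> *v ?r x) + ?r y))))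
        * exp (- (pi * \<i> * of_nat N * (?r x \<cdot> (\<Omega> *v ?r x))))"
      by (simp only: exp_add)
    moreover have "of_nat N *s (- (\<Omega> *v (?r x + ?c k)) + (?r y + ?c k'))
      = of_nat N *s (- (\<Omega> *v ?r x) + ?r y) + of_nat N *s (- (\<Omega> *v ?c k) + ?c k')"
      by (simp add: matrix_vector_right_distrib vec_eq_iff algebra_simps)
    ultimately show ?thesis
      by (simp add: p g F_tilde_def F_map_def real_action_def complex_action_def
          map_vec_of_real_add map_vec_of_real_of_int flip: mult.assoc)
  qed
  then show ?thesis
    by (simp add: equivariant_def)
qed

section \<open>Convergence of the theta series\<close>

lemma summable_on_prod_coordinates:
  fixes f :: "'n::finite \<Rightarrow> int \<Rightarrow> real"
  assumes "\<And>i. f i summable_on UNIV"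
  shows "(\<lambda>\<gamma>::int ^ 'n. \<Prod>i\<in>UNIV. f i (\<gamma> $ i)) summable_on UNIV"
proof -
  have "Infinite_Set_Sum.abs_summable_on (f i) UNIV" for i
    using assms[of i] summable_on_iff_abs_summable_on_real abs_summable_equivalent by blast
  then have "Infinite_Set_Sum.abs_summable_on (\<lambda>g. \<Prod>i\<in>UNIV. f i (g i)) (PiE UNIV (\<lambda>_. UNIV))"
    by (intro abs_summable_on_prod_PiE) auto
  then have "(\<lambda>g. \<Prod>i\<in>UNIV. f i (g i)) summable_on UNIV"
    unfolding abs_summable_equivalent[symmetric] summable_on_iff_abs_summable_on_real[symmetric]
    by (simp add: PiE_UNIV_domain)
  then show ?thesis
    by (subst summable_on_reindex_bij_witness[where i = vec_lambda and j = vec_nth and T = UNIV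
        and h = "\<lambda>g. \<Prod>i\<in>UNIV. f i (g i)"]) auto
qed

lemma summable_on_exp_minus_abs_int: "(\<lambda>k::int. exp (- \<bar>real_of_int k\<bar>)) summable_on UNIV"
proof -
  have "summable (\<lambda>n. exp (- 1 :: real) ^ n)"
    by (intro summable_geometric) simp
  then have "(\<lambda>n. exp (- real n)) summable_on UNIV"
    by (intro norm_summable_imp_summable_on) (simp flip: exp_of_nat_mult)
  then have "(\<lambda>k. exp (- \<bar>real_of_int k\<bar>)) summable_on range int"
    and "(\<lambda>k. exp (- \<bar>real_of_int k\<bar>)) summable_on range (\<lambda>n. - int n)"
    by (auto simp: summable_on_reindex inj_on_def o_def)
  moreover have "range int \<union> range (\<lambda>n. - int n) = UNIV"
    by (auto simp: image_iff) (metis int_cases2)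
  ultimately show ?thesis
    by (metis summable_on_union)
qed

text \<open>Completing the square in \<open>c u\<^sup>2 - (\<bar>b\<bar> + 1) \<bar>u\<bar>\<close> dominates the Gaussian by a constant multiple
  of \<open>exp (- \<bar>u\<bar>)\<close>.\<close>

lemma summable_on_shifted_gaussian_int:
  fixes a b c :: real
  assumes "0 < c"
  shows "(\<lambda>k::int. exp (- c * (k + a)\<^sup>2 + b * (k + a))) summable_on UNIV"
proof (rule summable_on_comparison_test)
  let ?K = "(\<bar>b\<bar> + 1)\<^sup>2 / (4 * c) + \<bar>a\<bar>"
  show "(\<lambda>k::int. exp ?K * exp (- \<bar>real_of_int k\<bar>)) summable_on UNIV"
    by (intro summable_on_cmult_right summable_on_exp_minus_abs_int)
  show "exp (- c * (k + a)\<^sup>2 + b * (k + a)) \<le> exp ?K * exp (- \<bar>real_of_int k\<bar>)" for k :: int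
  proof -
    define u where "u = k + a"
    have "0 \<le> c * (\<bar>u\<bar> - (\<bar>b\<bar> + 1) / (2 * c))\<^sup>2"
      using assms by simp
    also have "\<dots> = c * u\<^sup>2 - (\<bar>b\<bar> + 1) * \<bar>u\<bar> + (\<bar>b\<bar> + 1)\<^sup>2 / (4 * c)"
      using assms by (simp add: power2_diff power_divide field_simps)
        (simp add: power2_eq_square algebra_simps)
    finally have "(\<bar>b\<bar> + 1) * \<bar>u\<bar> \<le> c * u\<^sup>2 + (\<bar>b\<bar> + 1)\<^sup>2 / (4 * c)"
      by simp
    moreover have "b * u \<le> \<bar>b\<bar> * \<bar>u\<bar>"
      by (metis abs_ge_self abs_mult)
    moreover have "\<bar>real_of_int k\<bar> \<le> \<bar>u\<bar> + \<bar>a\<bar>"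
      unfolding u_def by linarith
    ultimately have "- c * u\<^sup>2 + b * u \<le> ?K - \<bar>real_of_int k\<bar>"
      by (simp add: algebra_simps)
    then show ?thesis
      by (simp add: u_def flip: exp_add)
  qed
qed simp

text \<open>The modulus of a term is a Gaussian in \<open>\<gamma> + a\<close> with quadratic form \<open>Im T\<close>.  Replacing this form
  by a multiple of the sum of squares makes the bound a product over the coordinates, and the
  sum over the lattice splits into one-dimensional sums.\<close>

lemma riemann_theta_term_summable:
  fixes T :: "complex ^ 'n ^ 'n"
  assumes "T \<in> siegel_upper_half_space"
  shows "riemann_theta_term a b z T summable_on UNIV"
proof -
  have "\<And>v. v \<noteq> 0 \<Longrightarrow> 0 < v \<bullet> (map_matrix Im T *v v)"
    using assms by (simp add: siegel_upper_half_space_def)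
  then obtain c where c: "c > 0" "\<And>v. c * (v \<bullet> v) \<le> v \<bullet> (map_matrix Im T *v v)"
    using positive_definite_lower_bound by blast
  define f where "f i k = exp (- (pi * c) * (real_of_int k + of_rat (a $ i))\<^sup>2
      + (- 2 * pi * Im (z $ i)) * (of_int k + of_rat (a $ i)))" for i and k :: int
  have bound: "norm (riemann_theta_term a b z T \<gamma>) \<le> (\<Prod>i\<in>UNIV. f i (\<gamma> $ i))" for \<gamma>
  proof -
    define u :: "real ^ 'n" where "u = map_vec of_int \<gamma> + map_vec of_rat a"
    have u: "map_vec of_int \<gamma> + map_vec of_rat a = map_vec complex_of_real u"
      by (simp add: u_def vec_eq_iff of_real_of_rat)
    have Im_z: "map_vec Im (z + map_vec of_rat b) = map_vec Im z"
      by (simp add: vec_eq_iff flip: of_real_of_rat)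
    have "norm (riemann_theta_term a b z T \<gamma>)
        = exp (- pi * (u \<bullet> (map_matrix Im T *v u)) - 2 * pi * (u \<bullet> map_vec Im z))"
      by (simp add: riemann_theta_term_def Let_def u Im_bdot_of_real Im_matrix_mult_of_real Im_z)
    also have "\<dots> \<le> exp (- pi * (c * (u \<bullet> u)) - 2 * pi * (u \<bullet> map_vec Im z))"
      using c(2)[of u] by simp
    also have "- pi * (c * (u \<bullet> u)) - 2 * pi * (u \<bullet> map_vec Im z)
        = (\<Sum>i\<in>UNIV. - (pi * c) * (u $ i)\<^sup>2 + (- 2 * pi * Im (z $ i)) * u $ i)"
      by (simp add: inner_vec_def sum_distrib_left sum_subtractf sum_negf sum.distrib
          power2_eq_square mult_ac)
    also have "exp \<dots> = (\<Prod>i\<in>UNIV. f i (\<gamma> $ i))"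
      by (simp add: exp_sum f_def u_def)
    finally show ?thesis .
  qed
  have "(\<lambda>\<gamma>. \<Prod>i\<in>UNIV. f i (\<gamma> $ i)) summable_on UNIV"
    unfolding f_def using c(1)
    by (intro summable_on_prod_coordinates summable_on_shifted_gaussian_int) simp
  then have "(\<lambda>\<gamma>. norm (riemann_theta_term a b z T \<gamma>)) summable_on UNIV"
    by (rule summable_on_comparison_test) (use bound in auto)
  then show ?thesis
    by (rule abs_summable_summable)
qed

section \<open>Comparison of the two theta functions\<close>

text \<open>Let \<open>u = \<gamma> + m/N\<close>.  The first series is quadratic in \<open>x - u\<close>; expanding by symmetry, the
  part free of \<open>u\<close> is the prefactor, the part linear in \<open>u\<close> pairs \<open>u\<close> with \<open>F (x, y)\<close> and the
  quadratic part is that of the Riemann theta series.\<close>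

lemma fibre_theta_term_eq:
  fixes \<Omega> :: "complex ^ 'n ^ 'n"
  assumes sym: "transpose \<Omega> = \<Omega>" and "0 < N"
  shows "fibre_theta_term N \<Omega> m (x, y) \<gamma>
    = exp (pi * \<i> * of_nat N * (map_vec of_real x \<cdot> (\<Omega> *v map_vec of_real x)))
      * riemann_theta_term (characteristic N m) 0 (F_map N \<Omega> (x, y)) (real N *\<^sub>R \<Omega>) \<gamma>"
proof -
  define u where "u = map_vec complex_of_int \<gamma> + map_vec of_rat (characteristic N m)"
  let ?x = "map_vec complex_of_real x" and ?y = "map_vec complex_of_real y"
  have v: "?x - map_vec of_int \<gamma> - map_vec of_rat (characteristic N m) = ?x - u"
    by (simp add: u_def algebra_simps)
  have m: "map_vec of_int m + of_nat N *s map_vec of_int \<gamma> = of_nat N *s u"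
    using \<open>0 < N\<close> by (simp add: u_def vec_eq_iff characteristic_def of_rat_divide field_simps)
  have N\<Omega>: "(real N *\<^sub>R \<Omega>) *v w = of_nat N *s (\<Omega> *v w)" for w
    by (simp add: vec_eq_iff matrix_vector_mult_def sum_distrib_left)
      (simp add: scaleR_conv_of_real mult_ac)
  have "2 * pi * \<i> * (of_nat N / 2 * ((?x - u) \<cdot> (\<Omega> *v (?x - u))) + (of_nat N *s u) \<cdot> ?y)
    = pi * \<i> * of_nat N * (?x \<cdot> (\<Omega> *v ?x))
      + (pi * \<i> * (u \<cdot> (of_nat N *s (\<Omega> *v u)))
         + 2 * pi * \<i> * (u \<cdot> (of_nat N *s (- (\<Omega> *v ?x) + ?y))))"
    using bdot_symmetric_matrix[OF sym, of ?x u]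
    by (simp add: matrix_vector_mult_diff_distrib bdot_linear algebra_simps)
  from arg_cong[OF this, of exp] show ?thesis
    by (simp add: fibre_theta_term_def riemann_theta_term_def Let_def v m N\<Omega> F_map_def exp_add
        flip: u_def)
qed

theorem theorem4p9:
  fixes N :: nat and Z \<Omega> :: "complex ^ 'n ^ 'n"
  assumes "0 < N"
    and "Z \<in> siegel_upper_half_space"
    and "\<Omega> = Omega Z"
  shows
    "(invertible (map_matrix cnj Z) \<and> \<Omega> = matrix_inv (map_matrix cnj Z))
     \<and>
     (J_standard \<circ> F_map N \<Omega> = F_map N \<Omega> \<circ> J_siegel Z
      \<and> Vector_Spaces.linear (scale_of_J (J_siegel Z)) (*s) (F_map N \<Omega>)
      \<and> bij (F_map N \<Omega>))
     \<and>
     (is_action (real_action N :: (int ^ 'n) \<times> (int ^ 'n) \<Rightarrow> _)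
      \<and> is_action (complex_action N \<Omega>)
      \<and> equivariant (real_action N) (complex_action N \<Omega>) (F_tilde N \<Omega>))
     \<and>
     (real N *\<^sub>R \<Omega> \<in> siegel_upper_half_space
      \<and> (\<forall>m. (\<forall>i. characteristic N m $ i \<in> {0..<1}) \<longrightarrow>
        (\<forall>x y.
          fibre_theta_term N \<Omega> m (x, y) summable_on UNIV
          \<and> riemann_theta_term (characteristic N m) 0 (F_map N \<Omega> (x, y)) (real N *\<^sub>R \<Omega>)
              summable_on UNIV
          \<and> F_tilde N \<Omega> (section_of (fibre_theta N \<Omega> m) (x, y))
            = section_of (\<lambda>z. riemann_theta (characteristic N m) 0 z (real N *\<^sub>R \<Omega>))
                (F_map N \<Omega> (x, y))
          \<and> fibre_theta N \<Omega> m (x, y)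
            = exp (pi * \<i> * of_nat N * (map_vec of_real x \<cdot> (\<Omega> *v map_vec of_real x)))
              * riemann_theta (characteristic N m) 0
                  (of_nat N *s (- (\<Omega> *v map_vec of_real x) + map_vec of_real y))
                  (real N *\<^sub>R \<Omega>))))"
proof -
  note N = \<open>0 < N\<close> and Z = \<open>Z \<in> siegel_upper_half_space\<close> and \<Omega> = \<open>\<Omega> = Omega Z\<close>
  have siegel: "\<Omega> \<in> siegel_upper_half_space"
    by (simp add: \<Omega> Omega_in_siegel Z)
  then have sym: "transpose \<Omega> = \<Omega>"
    by (simp add: siegel_upper_half_space_def)
  have N_siegel: "real N *\<^sub>R \<Omega> \<in> siegel_upper_half_space"
    using siegel N by (intro siegel_scaleR) simp_all
  have bij: "bij (F_map N \<Omega>)"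
    by (simp add: \<Omega> bij_F_map Z N)
  have J: "F_map N \<Omega> (J_siegel Z p) = \<i> *s F_map N \<Omega> p" for p
    by (simp add: \<Omega> F_map_J_siegel Z)
  have intertwines: "J_standard \<circ> F_map N \<Omega> = F_map N \<Omega> \<circ> J_siegel Z"
    by (simp add: fun_eq_iff J_standard_def J)
  have linear: "Vector_Spaces.linear (scale_of_J (J_siegel Z)) (*s) (F_map N \<Omega>)"
    using bij by (intro linear_scale_of_J bij_is_inj F_map_add F_map_scaleR J)
  let ?E = "\<lambda>x. pi * \<i> * of_nat N * (map_vec of_real x \<cdot> (\<Omega> *v map_vec of_real x))"
  have riemann: "riemann_theta_term (characteristic N m) 0 z (real N *\<^sub>R \<Omega>) summable_on UNIV"
    for m z
    by (intro riemann_theta_term_summable N_siegel)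
  have fibre: "fibre_theta_term N \<Omega> m (x, y) summable_on UNIV" for m x y
    using summable_on_cmult_right[OF riemann]
    by (simp add: fibre_theta_term_eq[OF sym N] cong: summable_on_cong)
  have theta: "fibre_theta N \<Omega> m (x, y)
      = exp (?E x) * riemann_theta (characteristic N m) 0 (F_map N \<Omega> (x, y)) (real N *\<^sub>R \<Omega>)"
    for m x y
    by (simp add: fibre_theta_def riemann_theta_def fibre_theta_term_eq[OF sym N]
        infsum_cmult_right')
  have section_eq: "F_tilde N \<Omega> (section_of (fibre_theta N \<Omega> m) (x, y))
      = section_of (\<lambda>z. riemann_theta (characteristic N m) 0 z (real N *\<^sub>R \<Omega>)) (F_map N \<Omega> (x, y))"
    for m x y
    by (simp add: F_tilde_def section_of_def theta flip: mult.assoc exp_add)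
  have theta_explicit: "fibre_theta N \<Omega> m (x, y) = exp (?E x) * riemann_theta (characteristic N m) 0
      (of_nat N *s (- (\<Omega> *v map_vec of_real x) + map_vec of_real y)) (real N *\<^sub>R \<Omega>)" for m x y
    by (simp add: theta F_map_def)
  have inverse: "\<Omega> = matrix_inv (map_matrix cnj Z)"
    by (simp add: \<Omega> Omega_eq_matrix_inv_cnj Z)
  show ?thesis
    by (intro conjI allI impI)
      (rule invertible_cnj_siegel[OF Z] inverse intertwines linear bij N_siegel riemann fibre section_eq
        theta_explicit is_action_real_action is_action_complex_action[OF sym]
        equivariant_F_tilde[OF sym])+
qed

end
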